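(* Let $A$ be a finite alphabet. For every sentence $I$ over $A$, the comultiplication of the coloured ribbon non-commutative Schur function $R_I$ in $\mathrm{NSym}_A$ is $$\Delta(R_I)=\sum_{J,K}\langle F_{J\star_F K},R_I\rangle\,R_J\otimes R_K,$$ where the sum is over all sentences $J,K$ over $A$, and $F_{J\star_F K}$ denotes $\sum_L F_L$ over the summands $L$ (counted with multiplicity) of the fundamental shuffle $J\star_F K$.
   Context: $\Bbbk$ is a field of characteristic zero. A sentence $I=(w_1,\dots,w_m)$ over $A$ is a finite sequence of non-empty words in letters of $A$; $1$ is the empty sentence; its maximal word is $w(I)=w_1\cdots w_m$. $I\cdot J$ is concatenation of sequences of words. Write $J\preccurlyeq I$ ($J$ refines $I$) if the words of $I$ can be obtained by concatenating adjacent words of $J$. $\mathrm{NSym}_A$ is the Hopf algebra over $\Bbbk$ with linear basis $(H_I)$ indexed by sentences, graded by the total number of letters, with product $H_IH_J=H_{I\cdot J}$ and coproduct $\Delta(H_I)=\sum_{J\subset I}H_{\widetilde{I\setminus J}}\otimes H_{\widetilde J}$. Here, for $I=(w_1,\dots,w_m)$, $J=(v_1,\dots,v_m)$ runs over sequences of possibly empty words such that $w_i=u_iv_i$ for some words $u_i$; $I\setminus J=(u_1,\dots,u_m)$; and tilde means deleting the empty words. $\mathrm{QSym}_A$ is its graded dual Hopf algebra with basis $(M_I)$ dual to $(H_I)$: $\langle M_I,H_J\rangle=\delta_{I,J}$. The fundamental functions $F_I=\sum_{J\preccurlyeq I}M_J$ form a basis of $\mathrm{QSym}_A$, and $(R_I)$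 is the basis of $\mathrm{NSym}_A$ dual to it: $\langle F_I,R_J\rangle=\delta_{I,J}$. Fundamental shuffle $I\star_F J$ of sentences: (1) take the ordinary shuffle of the letters of the maximal words $w(I)$ and $w(J)$, i.e. the formal sum of all interleavings (counted with multiplicity, remembering from which word of which sentence each letter comes), each viewed as a sentence of one-letter words; (2) in each summand concatenate neighbouring letters coming from the same word of $I$, and neighbouring letters coming from the same word of $J$; (3) then concatenate pairs of neighbouring subwords consisting of a subword of a word of $I$ followed by a subword of a word of $J$ (in this order). Equivalently, in an interleaving $c_1c_2\cdots c_n$ there is no word separation between $c_p$ and $c_{p+1}$ exactly when both come from the same word of $I$, or both come from the same word of $J$, or $c_p$ comes from $I$ and $c_{p+1}$ comes from $J$. For example, $(a,c)\star_F(b)=(a,cb)+(ab,c)+(b,a,c)$. *)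

theory Defs
  imports "HOL-Library.Poly_Mapping" "HOL-Library.Multiset"
begin

section \<open>Sentences\<close>

typedef 'a sentence = "{I :: 'a list list. [] \<notin> set I}"
  morphisms sentence_words Sentence
  by (rule exI[of _ "[]"]) simp

setup_lifting type_definition_sentence

text \<open>The tilde operation: a sequence of possibly empty words becomes a sentence by
  deleting the empty words.\<close>

lift_definition tilde :: "'a list list \<Rightarrow> 'a sentence"
  is "filter (\<lambda>w. w \<noteq> [])"
  by simp

definition maximal_word :: "'a sentence \<Rightarrow> 'a list"
  where "maximal_word I = concat (sentence_words I)"

text \<open>\<open>refines J I\<close>: the words of \<open>J\<close> can be bracketed into consecutive groups \<open>G\<close> whose
  concatenations are the words of \<open>I\<close>. Empty groups cannot occur, because the words of
  \<open>I\<close> are non-empty.\<close>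

definition refines :: "'a sentence \<Rightarrow> 'a sentence \<Rightarrow> bool"  (infix "\<preceq>" 50)
  where "J \<preceq> I \<longleftrightarrow> (\<exists>G. sentence_words J = concat G \<and> sentence_words I = map concat G)"

section \<open>The spaces \<open>NSym\<close> and \<open>QSym\<close> and their pairing\<close>

text \<open>An element is given by its finitely many non-zero coordinates: with respect to
  \<open>(H\<^sub>I)\<close> in \<open>NSym\<close>, and to the dual basis \<open>(M\<^sub>I)\<close> in the graded dual \<open>QSym\<close>. Accordingly
  \<open>NSym \<otimes> NSym\<close> has coordinates with respect to the basis \<open>H\<^sub>I \<otimes> H\<^sub>J\<close>, indexed by
  pairs of sentences.\<close>

type_synonym ('a, 'k) nsym = "'a sentence \<Rightarrow>\<^sub>0 'k"
type_synonym ('a, 'k) qsym = "'a sentence \<Rightarrow>\<^sub>0 'k"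
type_synonym ('a, 'k) nsym_tensor = "('a sentence \<times> 'a sentence) \<Rightarrow>\<^sub>0 'k"

definition H :: "'a sentence \<Rightarrow> ('a, 'k::field_char_0) nsym"
  where "H I = Poly_Mapping.single I 1"

definition M :: "'a sentence \<Rightarrow> ('a, 'k::field_char_0) qsym"
  where "M I = Poly_Mapping.single I 1"

definition pairing :: "('a, 'k::field_char_0) qsym \<Rightarrow> ('a, 'k) nsym \<Rightarrow> 'k"
    ("\<langle>_, _\<rangle>")
  where "\<langle>f, x\<rangle> =
    (\<Sum>I\<in>Poly_Mapping.keys f. Poly_Mapping.lookup f I * Poly_Mapping.lookup x I)"

definition scale :: "'k::field_char_0 \<Rightarrow> ('b \<Rightarrow>\<^sub>0 'k) \<Rightarrow> ('b \<Rightarrow>\<^sub>0 'k)"  (infixr "\<cdot>" 75)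
  where "c \<cdot> x = Poly_Mapping.map ((*) c) x"

definition tensor :: "('a, 'k::field_char_0) nsym \<Rightarrow> ('a, 'k) nsym \<Rightarrow> ('a, 'k) nsym_tensor"
    (infixr "\<otimes>" 76)
  where "x \<otimes> y = (\<Sum>P\<in>Poly_Mapping.keys x. \<Sum>Q\<in>Poly_Mapping.keys y.
    Poly_Mapping.single (P, Q) (Poly_Mapping.lookup x P * Poly_Mapping.lookup y Q))"

section \<open>The coproduct of \<open>NSym\<close>\<close>

text \<open>A sequence \<open>J = (v\<^sub>1, \<dots>, v\<^sub>m)\<close> with \<open>w\<^sub>i = u\<^sub>i v\<^sub>i\<close> is recorded together with
  \<open>I \<setminus> J = (u\<^sub>1, \<dots>, u\<^sub>m)\<close>, which it determines, as the list of pairs \<open>(u\<^sub>i, v\<^sub>i)\<close>.\<close>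

definition splittings :: "'a sentence \<Rightarrow> ('a list \<times> 'a list) list set"
  where "splittings I = {D. map (\<lambda>(u, v). u @ v) D = sentence_words I}"

definition coproduct_H :: "'a sentence \<Rightarrow> ('a, 'k::field_char_0) nsym_tensor"
  where "coproduct_H I =
    (\<Sum>D\<in>splittings I. H (tilde (map fst D)) \<otimes> H (tilde (map snd D)))"

definition coproduct :: "('a, 'k::field_char_0) nsym \<Rightarrow> ('a, 'k) nsym_tensor"  ("\<Delta>")
  where "\<Delta> x = (\<Sum>I\<in>Poly_Mapping.keys x. Poly_Mapping.lookup x I \<cdot> coproduct_H I)"

section \<open>Fundamental functions and ribbons\<close>

definition F :: "'a sentence \<Rightarrow> ('a, 'k::field_char_0) qsym"
  where "F I = (\<Sum>J\<in>{J. J \<preceq> I}. M J)"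

text \<open>The dual family exists and is unique; see \<open>ex1_dual_F\<close> below.\<close>

definition R :: "'a sentence \<Rightarrow> ('a, 'k::field_char_0) nsym"
  where "R I = (THE r. \<forall>J. \<langle>F J, r\<rangle> = (if J = I then 1 else 0))"

section \<open>The fundamental shuffle\<close>

text \<open>Each letter of the maximal word, tagged with the position of the word it comes from.\<close>

definition tagged_letters :: "'a sentence \<Rightarrow> (nat \<times> 'a) list"
  where "tagged_letters I = concat (map (\<lambda>(i, w). map (Pair i) w) (enumerate 0 (sentence_words I)))"

text \<open>\<open>Inl\<close> marks the letters of the first sentence and \<open>Inr\<close> those of the second. Hence
  different interleavings are different lists, and this set counts them with
  multiplicity.\<close>

definition interleavings ::
    "'a sentence \<Rightarrow> 'a sentence \<Rightarrow> ((nat \<times> 'a) + (nat \<times> 'a)) list set"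
  where "interleavings I J = shuffles (map Inl (tagged_letters I)) (map Inr (tagged_letters J))"

text \<open>Whether there is no word separation between two neighbouring letters.\<close>

fun joined :: "(nat \<times> 'a) + (nat \<times> 'a) \<Rightarrow> (nat \<times> 'a) + (nat \<times> 'a) \<Rightarrow> bool"
  where
    "joined (Inl (i, _)) (Inl (j, _)) \<longleftrightarrow> i = j"
  | "joined (Inr (i, _)) (Inr (j, _)) \<longleftrightarrow> i = j"
  | "joined (Inl _) (Inr _) \<longleftrightarrow> True"
  | "joined (Inr _) (Inl _) \<longleftrightarrow> False"

text \<open>Cut a list between any two neighbours not related by \<open>P\<close>.\<close>

fun segments :: "('c \<Rightarrow> 'c \<Rightarrow> bool) \<Rightarrow> 'c list \<Rightarrow> 'c list list"
  where
    "segments P [] = []"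
  | "segments P [c] = [[c]]"
  | "segments P (c # d # cs) =
      (if P c d then (c # hd (segments P (d # cs))) # tl (segments P (d # cs))
       else [c] # segments P (d # cs))"

text \<open>No segment is empty, so \<open>tilde\<close> only serves as a conversion to sentences here.\<close>

definition sentence_of_interleaving :: "((nat \<times> 'a) + (nat \<times> 'a)) list \<Rightarrow> 'a sentence"
  where "sentence_of_interleaving c = tilde (map (map (case_sum snd snd)) (segments joined c))"

definition fundamental_shuffle :: "'a sentence \<Rightarrow> 'a sentence \<Rightarrow> 'a sentence multiset"
    (infixl "\<star>\<^sub>F" 70)
  where "I \<star>\<^sub>F J = image_mset sentence_of_interleaving (mset_set (interleavings I J))"

definition F_sum :: "'a sentence multiset \<Rightarrow> ('a, 'k::field_char_0) qsym"
  where "F_sum X = (\<Sum>L\<in>#X. F L)"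

section \<open>Ribbons are well defined\<close>

lemma sentence_words_nonempty: "w \<in> set (sentence_words I) \<Longrightarrow> w \<noteq> []"
  using sentence_words[of I] by auto

lemma refines_refl: "I \<preceq> I"
  unfolding refines_def
  by (rule exI[of _ "map (\<lambda>w. [w]) (sentence_words I)"]) (simp add: comp_def)

lemma refines_maximal_word: "J \<preceq> I \<Longrightarrow> maximal_word J = maximal_word I"
proof -
  have "concat (map concat G) = concat (concat G)" for G :: "'a list list list"
    by (induction G) auto
  then show "J \<preceq> I \<Longrightarrow> maximal_word J = maximal_word I"
    unfolding refines_def maximal_word_def by auto
qed

lemma refines_length_less:
  assumes "J \<preceq> I" "J \<noteq> I"
  shows "length (sentence_words I) < length (sentence_words J)"
proof -
  obtain G where G: "sentence_words J = concat G" "sentence_words I = map concat G"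
    using assms(1) unfolding refines_def by blast
  have ne: "g \<noteq> []" if "g \<in> set G" for g
    using that sentence_words_nonempty[of "concat g" I] G(2) by force
  have "length (concat G) > length G \<or> concat G = map concat G" using ne
  proof (induction G)
    case (Cons g G)
    then have IH: "length G < length (concat G) \<or> concat G = map concat G" by simp
    have "g \<noteq> []" using Cons.prems by simp
    then obtain a as where g: "g = a # as" by (cases g) auto
    have le: "length G \<le> length (concat G)" using IH by (metis length_map less_imp_le order_refl)
    show ?case using IH g le by (cases as) auto
  qed simp
  moreover have "concat G \<noteq> map concat G"
    using G assms(2) by (metis sentence_words_inject)
  ultimately show ?thesis using G by simp
qed

lemma finite_maximal_word: "finite {J. maximal_word J = u}"
proof -
  let ?W = "{w. set w \<subseteq> set u \<and> length w \<le> length u}"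
  let ?L = "{ws. set ws \<subseteq> ?W \<and> length ws \<le> length u}"
  have "sentence_words ` {J. maximal_word J = u} \<subseteq> ?L"
  proof clarsimp
    fix J :: "'a sentence"
    let ?ws = "sentence_words J"
    have mem: "set w \<subseteq> set (concat ws) \<and> length w \<le> length (concat ws)" if "w \<in> set ws"
      for w :: "'a list" and ws
      using that by (induction ws) auto
    have "length ws \<le> length (concat ws)" if "\<forall>w\<in>set ws. w \<noteq> []" for ws :: "'a list list"
      using that
    proof (induction ws)
      case (Cons w ws)
      then show ?case by (cases w) auto
    qed simp
    then have len: "length ?ws \<le> length (maximal_word J)"
      using sentence_words_nonempty unfolding maximal_word_def by blast
    then show "set ?ws \<subseteq> {w. set w \<subseteq> set (maximal_word J)
        \<and> length w \<le> length (maximal_word J)} \<and> length ?ws \<le> length (maximal_word J)"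
      using mem[of _ ?ws] unfolding maximal_word_def by auto
  qed
  moreover have "finite ?L"
    using finite_lists_length_le[OF finite_lists_length_le[of "set u" "length u"], of "length u"]
    by simp
  ultimately show ?thesis
    by (meson finite_imageD finite_subset inj_onI sentence_words_inject)
qed

lemma finite_refinements: "finite {J. J \<preceq> I}"
  by (rule finite_subset[OF _ finite_maximal_word[of "maximal_word I"]])
    (auto dest: refines_maximal_word)

lemma finite_coarsenings: "finite {J. I \<preceq> J}"
  by (rule finite_subset[OF _ finite_maximal_word[of "maximal_word I"]])
    (auto dest: refines_maximal_word)

lemma lookup_F: "Poly_Mapping.lookup (F J) K = (if K \<preceq> J then 1 else 0)"
  unfolding F_def M_def
  by (simp add: lookup_sum lookup_single when_def finite_refinements)

lemma pairing_F:
  fixes x :: "('a, 'k::field_char_0) nsym"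
  shows "\<langle>F J, x\<rangle> = (\<Sum>K\<in>{K. K \<preceq> J}. Poly_Mapping.lookup x K)"
proof -
  have "Poly_Mapping.keys (F J :: ('a, 'k) qsym) = {K. K \<preceq> J}"
    by (auto simp: in_keys_iff lookup_F split: if_splits)
  then show ?thesis by (simp add: pairing_def lookup_F)
qed

lemma pairing_M_H: "\<langle>M I, H J\<rangle> = (if I = J then 1 else 0)"
  by (simp add: pairing_def M_def H_def lookup_single when_def)

lemma dual_F_unique:
  fixes x y :: "('a, 'k::field_char_0) nsym"
  assumes "\<And>J. \<langle>F J, x\<rangle> = \<langle>F J, y\<rangle>"
  shows "x = y"
proof (rule poly_mapping_eqI)
  fix J
  show "Poly_Mapping.lookup x J = Poly_Mapping.lookup y J"
  proof (induction "length (maximal_word J) - length (sentence_words J)"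
      arbitrary: J rule: less_induct)
    case less
    have split: "{K. K \<preceq> J} = insert J {K. K \<preceq> J \<and> K \<noteq> J}"
      using refines_refl by auto
    have fin: "finite {K. K \<preceq> J \<and> K \<noteq> J}"
      by (rule finite_subset[OF _ finite_refinements[of J]]) auto
    have le: "length ws \<le> length (concat ws)" if "\<forall>w\<in>set ws. w \<noteq> []" for ws :: "'a list list"
      using that
    proof (induction ws)
      case (Cons w ws)
      then show ?case by (cases w) auto
    qed simp
    have "Poly_Mapping.lookup x K = Poly_Mapping.lookup y K" if "K \<preceq> J" "K \<noteq> J" for K
    proof (rule less)
      have "length (sentence_words K) \<le> length (maximal_word K)"
        using le sentence_words_nonempty unfolding maximal_word_def by blast
      then show "length (maximal_word K) - length (sentence_words K)
          < length (maximal_word J) - length (sentence_words J)"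
        using refines_length_less[OF that] refines_maximal_word[OF that(1)] by simp
    qed
    then have "(\<Sum>K\<in>{K. K \<preceq> J \<and> K \<noteq> J}. Poly_Mapping.lookup x K)
        = (\<Sum>K\<in>{K. K \<preceq> J \<and> K \<noteq> J}. Poly_Mapping.lookup y K)"
      by (intro sum.cong) auto
    then show ?case
      using assms[of J] fin unfolding pairing_F split by simp
  qed
qed

lemma dual_F_exists:
  "\<exists>r :: ('a, 'k::field_char_0) nsym. \<forall>J. \<langle>F J, r\<rangle> = (if J = I then 1 else 0)"
proof (induction "length (sentence_words I)" arbitrary: I rule: less_induct)
  case less
  let ?C = "{K. I \<preceq> K \<and> K \<noteq> I}"
  have "\<forall>K\<in>?C. \<exists>r :: ('a, 'k) nsym. \<forall>J. \<langle>F J, r\<rangle> = (if J = K then 1 else 0)"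
    using less refines_length_less by blast
  then obtain \<rho> :: "'a sentence \<Rightarrow> ('a, 'k) nsym"
    where \<rho>: "\<And>K J. K \<in> ?C \<Longrightarrow> \<langle>F J, \<rho> K\<rangle> = (if J = K then 1 else 0)"
    by metis
  have fin: "finite ?C"
    by (rule finite_subset[OF _ finite_coarsenings[of I]]) auto
  have "\<langle>F J, H I - sum \<rho> ?C\<rangle> = (if J = I then 1 else 0)" for J
  proof -
    have "\<langle>F J, H I - sum \<rho> ?C\<rangle>
        = (\<Sum>K\<in>{K. K \<preceq> J}. Poly_Mapping.lookup (H I) K) - (\<Sum>L\<in>?C. \<langle>F J, \<rho> L\<rangle>)"
      by (simp add: pairing_F lookup_minus lookup_sum sum_subtractf) (rule sum.swap)
    also have "(\<Sum>K\<in>{K. K \<preceq> J}. Poly_Mapping.lookup (H I :: ('a, 'k) nsym) K)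
        = (if I \<preceq> J then 1 else 0)"
      by (simp add: H_def lookup_single when_def finite_refinements)
    also have "(\<Sum>L\<in>?C. \<langle>F J, \<rho> L\<rangle>) = (\<Sum>L\<in>?C. if J = L then 1 else 0)"
      by (intro sum.cong) (auto simp: \<rho>)
    also have "\<dots> = (if J \<in> ?C then 1 else 0)"
      using fin by simp
    finally show ?thesis using refines_refl by auto
  qed
  then show ?case by blast
qed

lemma ex1_dual_F:
  "\<exists>!r :: ('a, 'k::field_char_0) nsym. \<forall>J. \<langle>F J, r\<rangle> = (if J = I then 1 else 0)"
  using dual_F_exists[of I] dual_F_unique by (metis (no_types, lifting))

lemma pairing_F_R: "\<langle>F J, R I\<rangle> = (if J = I then 1 else 0)"
  using theI'[OF ex1_dual_F[of I]] unfolding R_def by blast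

end

theory Submission
  imports Defs
begin

text \<open>Since the \<open>R\<^sub>J \<otimes> R\<^sub>K\<close> are dual to the \<open>F\<^sub>J \<otimes> F\<^sub>K\<close>, the claim says that \<open>F\<^bsub>J \<star> K\<^esub>\<close> is the
  product of \<open>F\<^sub>J\<close> and \<open>F\<^sub>K\<close> dual to the coproduct. Tested against \<open>H\<^sub>L\<close>, this is a count:
  the splittings \<open>w\<^sub>i = u\<^sub>i v\<^sub>i\<close> of \<open>L\<close> for which the \<open>u\<^sub>i\<close> refine \<open>J\<close> and the \<open>v\<^sub>i\<close> refine \<open>K\<close> are
  as many as the interleavings of \<open>J\<close> and \<open>K\<close> whose sentence is refined by \<open>L\<close>. Both
  are in bijection with the lists of pairs \<open>(x\<^sub>i, y\<^sub>i)\<close> of tagged words, where \<open>x\<^sub>i\<close> and \<open>y\<^sub>i\<close> carry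
  constant tags, the \<open>x\<^sub>i\<close> concatenate to the tagged letters of \<open>J\<close> and the \<open>y\<^sub>i\<close> to those of \<open>K\<close>,
  and \<open>x\<^sub>i y\<^sub>i\<close> is \<open>w\<^sub>i\<close> without tags: the words admitted between two separations of
  an interleaving are exactly the words \<open>x y\<close> of this form.\<close>

section \<open>Segments and refinement\<close>

lemma segments_eq_Nil_iff [simp]: "segments P c = [] \<longleftrightarrow> c = []"
  by (induction P c rule: segments.induct) auto

text \<open>Cuts depend only on neighbouring letters, so a block without inner cuts acts like a
  single letter in the recursion of \<open>segments\<close>: only the seam with \<open>c\<close>
  decides.\<close>

lemma segments_append:
  assumes "successively P t" "t \<noteq> []" "c \<noteq> []"
  shows "segments P (t @ c) =
    (if P (last t) (hd c) then (t @ hd (segments P c)) # tl (segments P c)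
     else t # segments P c)"
  using assms
proof (induction t)
  case (Cons a t)
  show ?case
  proof (cases t)
    case Nil
    then show ?thesis using Cons.prems by (cases c) auto
  next
    case (Cons b t')
    then show ?thesis using Cons.IH Cons.prems by (auto simp: successively_Cons)
  qed
qed simp

lemma segments_successively: "successively P t \<Longrightarrow> t \<noteq> [] \<Longrightarrow> segments P t = [t]"
  by (induction P t rule: segments.induct) auto

text \<open>The third conjunct serves the induction: a letter put in front of the first segment must
  be related by \<open>P\<close> to the head of that segment.\<close>

lemma segments_properties:
  "concat (segments P c) = c \<and> (\<forall>s\<in>set (segments P c). s \<noteq> [] \<and> successively P s)
    \<and> (c \<noteq> [] \<longrightarrow> hd (hd (segments P c)) = hd c)"
proof (induction P c rule: segments.induct)
  case (3 P c d cs)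
  then show ?case
    by (cases "segments P (d # cs)") (auto simp: successively_Cons)
qed auto

lemma concat_segments: "concat (segments P c) = c"
  and segments_nonempty: "s \<in> set (segments P c) \<Longrightarrow> s \<noteq> []"
  and successively_segments: "s \<in> set (segments P c) \<Longrightarrow> successively P s"
  using segments_properties[of P c] by auto

text \<open>With \<open>f\<close> forgetting tags, this lifts a cutting of an untagged word to the
  tagged one.\<close>

lemma concat_eq_map_obtain:
  assumes "concat g = map f s"
  obtains T where "concat T = s" "map (map f) T = g"
proof -
  have "\<exists>T. concat T = s \<and> map (map f) T = g" using assms
  proof (induction g arbitrary: s)
    case (Cons w g)
    then obtain s1 s2 where s: "s = s1 @ s2" "map f s1 = w" "map f s2 = concat g"
      by (auto simp: append_eq_map_conv)
    then obtain T where "concat T = s2" "map (map f) T = g"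
      using Cons.IH by metis
    then show ?case using s by (intro exI[of _ "s1 # T"]) simp
  qed simp
  then show thesis using that by blast
qed

lemma map_concat_eq_map_map_obtain:
  assumes "map concat G = map (map f) S"
  obtains T where "map concat T = S" "map (map (map f)) T = G"
proof -
  have "\<exists>T. map concat T = S \<and> map (map (map f)) T = G" using assms
  proof (induction G arbitrary: S)
    case (Cons g G)
    then obtain s S' where S: "S = s # S'" "concat g = map f s" "map concat G = map (map f) S'"
      by (cases S) auto
    obtain t where "concat t = s" "map (map f) t = g"
      using concat_eq_map_obtain[OF S(2)] .
    moreover obtain T where "map concat T = S'" "map (map (map f)) T = G"
      using Cons.IH S(3) by blast
    ultimately show ?case using S(1) by (intro exI[of _ "t # T"]) simp
  qed simp
  then show thesis using that by blast
qed

lemma successively_concatD: "successively P (concat T) \<Longrightarrow> t \<in> set T \<Longrightarrow> successively P t"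
  by (induction T) (auto simp: successively_append_iff)

lemma concat_map_concat: "concat (map concat T) = concat (concat T)"
  by (induction T) auto

text \<open>A \<open>P\<close>-chain never straddles a cut. Built from the right, each block
  therefore extends the first group or opens a new one, which yields the bracketing needed for
  \<open>refines\<close>.\<close>

lemma segments_grouping:
  assumes "\<forall>t\<in>set T. t \<noteq> [] \<and> successively P t"
  shows "\<exists>G. map (map f) T = concat G \<and> map (map f) (segments P (concat T)) = map concat G"
  using assms
proof (induction T)
  case (Cons t T)
  then obtain G where G: "map (map f) T = concat G"
      "map (map f) (segments P (concat T)) = map concat G"
    by auto
  have t: "t \<noteq> []" "successively P t" using Cons.prems by auto
  show ?case
  proof (cases "T = []")
    case True
    then show ?thesis
      using t by (intro exI[of _ "[[map f t]]"]) (simp add: segments_successively)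
  next
    case False
    then have ne: "concat T \<noteq> []" using Cons.prems by (cases T) auto
    then obtain s S where S: "segments P (concat T) = s # S"
      by (cases "segments P (concat T)") auto
    then obtain g G' where G': "G = g # G'" using G(2) by (cases G) auto
    show ?thesis
    proof (cases "P (last t) (hd (concat T))")
      case True
      then show ?thesis using G G' S t ne
        by (intro exI[of _ "(map f t # g) # G'"]) (simp add: segments_append)
    next
      case False
      then show ?thesis using G G' S t ne
        by (intro exI[of _ "[map f t] # G"]) (simp add: segments_append)
    qed
  qed
qed simp

text \<open>Segments are the maximal \<open>P\<close>-chains, so any cutting of \<open>c\<close>
  into chains only adds cuts to those of \<open>segments\<close>, and conversely pieces of segments
  are chains.\<close>

lemma refines_segments_iff:
  assumes N: "sentence_words N = map (map f) (segments P c)"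
  shows "L \<preceq> N \<longleftrightarrow>
    (\<exists>T. concat T = c \<and> map (map f) T = sentence_words L \<and> (\<forall>t\<in>set T. successively P t))"
proof
  assume "L \<preceq> N"
  then obtain G where G: "sentence_words L = concat G" "map concat G = map (map f) (segments P c)"
    using N unfolding refines_def by metis
  obtain T where T: "map concat T = segments P c" "map (map (map f)) T = G"
    using map_concat_eq_map_map_obtain[OF G(2)] .
  have "concat (concat T) = c"
    using T(1) by (metis concat_map_concat concat_segments)
  moreover have "map (map f) (concat T) = sentence_words L"
    using T(2) G(1) by (metis map_concat)
  moreover have "successively P t" if t: "t \<in> set (concat T)" for t
  proof -
    obtain ts where ts: "ts \<in> set T" "t \<in> set ts" using t by auto
    have "concat ts \<in> set (segments P c)" using ts(1) by (simp flip: T(1))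
    then show ?thesis using ts(2) successively_segments successively_concatD by blast
  qed
  ultimately show "\<exists>T. concat T = c \<and> map (map f) T = sentence_words L
      \<and> (\<forall>t\<in>set T. successively P t)"
    by blast
next
  assume "\<exists>T. concat T = c \<and> map (map f) T = sentence_words L \<and> (\<forall>t\<in>set T. successively P t)"
  then obtain T where T: "concat T = c" "map (map f) T = sentence_words L"
      "\<forall>t\<in>set T. successively P t"
    by blast
  have "t \<noteq> []" if "t \<in> set T" for t
    using that sentence_words_nonempty[of "map f t" L] by (simp flip: T(2))
  then show "L \<preceq> N"
    using segments_grouping[of T P f] T N unfolding refines_def by metis
qed

section \<open>Refinement of a sentence in terms of its tagged letters\<close>

abbreviation same_tag :: "nat \<times> 'a \<Rightarrow> nat \<times> 'a \<Rightarrow> bool"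
  where "same_tag p q \<equiv> fst p = fst q"

text \<open>Tags are constant on a word and change between consecutive words, so the cuts recover
  \<open>ws\<close>. The offset \<open>n\<close> is free because the induction shifts it.\<close>

lemma map_segments_enumerate:
  assumes "\<forall>w\<in>set ws. w \<noteq> []"
  shows "map (map snd) (segments same_tag
    (concat (map (\<lambda>(i, w). map (Pair i) w) (enumerate n ws)))) = ws"
  using assms
proof (induction ws arbitrary: n)
  case (Cons w ws)
  let ?t = "map (Pair n) w"
  let ?c = "concat (map (\<lambda>(i, w). map (Pair i) w) (enumerate (Suc n) ws))"
  have w: "w \<noteq> []" "successively same_tag ?t"
    using Cons.prems by (auto simp: successively_map successively_conv_nth)
  show ?case
  proof (cases ws)
    case Nil
    then show ?thesis using w by (simp add: segments_successively comp_def)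
  next
    case (Cons w' ws')
    then have "w' \<noteq> []" using Cons.prems by simp
    then have "?c \<noteq> []" "fst (hd ?c) = Suc n"
      using Cons by (auto simp: hd_map)
    then show ?thesis
      using w Cons.IH[of "Suc n"] Cons.prems
      by (simp add: segments_append last_map comp_def)
  qed
qed simp

lemma sentence_words_eq_segments:
  "sentence_words J = map (map snd) (segments same_tag (tagged_letters J))"
  unfolding tagged_letters_def
  using map_segments_enumerate[of "sentence_words J" 0] sentence_words_nonempty by force

text \<open>Deleted empty words come back as empty blocks, which change no concatenation and satisfy
  \<open>Q\<close>.\<close>

lemma map_eq_filter_nonempty_iff:
  assumes "Q []"
  shows "(\<exists>X. concat X = c \<and> map (map f) X = filter (\<lambda>w. w \<noteq> []) Us \<and> (\<forall>x\<in>set X. Q x)) \<longleftrightarrow>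
    (\<exists>X. concat X = c \<and> map (map f) X = Us \<and> (\<forall>x\<in>set X. Q x))"  (is "?l \<longleftrightarrow> ?r")
proof
  show "?l \<Longrightarrow> ?r"
  proof (induction Us arbitrary: c)
    case (Cons u Us)
    show ?case
    proof (cases "u = []")
      case True
      then obtain X where "concat X = c" "map (map f) X = Us" "\<forall>x\<in>set X. Q x"
        using Cons by auto
      then show ?thesis using True assms by (intro exI[of _ "[] # X"]) simp
    next
      case False
      then obtain x X where X: "c = x @ concat X" "map f x = u" "Q x" "\<forall>x\<in>set X. Q x"
          "map (map f) X = filter (\<lambda>w. w \<noteq> []) Us"
        using Cons.prems by (force simp: map_eq_Cons_conv)
      then obtain X' where "concat X' = concat X" "map (map f) X' = Us" "\<forall>x\<in>set X'. Q x"
        using Cons.IH by blast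
      then show ?thesis using X by (intro exI[of _ "x # X'"]) simp
    qed
  qed simp
next
  assume ?r
  then obtain X where X: "concat X = c" "map (map f) X = Us" "\<forall>x\<in>set X. Q x" by blast
  have "map (map f) (filter (\<lambda>x. x \<noteq> []) X) = filter (\<lambda>w. w \<noteq> []) Us"
    unfolding X(2)[symmetric] by (simp add: filter_map comp_def)
  moreover have "concat (filter (\<lambda>x. x \<noteq> []) X) = c"
    unfolding X(1)[symmetric] by (induction X) auto
  ultimately show ?l using X(3) by (metis filter_is_subset subsetD)
qed

text \<open>Keeping the empty words of \<open>Us\<close> makes the blocks of \<open>X\<close>
  correspond one by one to the words being split, so that two such lists can later be
  zipped.\<close>

lemma tilde_refines_iff:
  "tilde Us \<preceq> J \<longleftrightarrow> (\<exists>X. concat X = tagged_letters J \<and> map (map snd) X = Us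
    \<and> (\<forall>x\<in>set X. successively same_tag x))"
  unfolding refines_segments_iff[OF sentence_words_eq_segments] tilde.rep_eq
  by (rule map_eq_filter_nonempty_iff) simp

lemma refines_sentence_of_interleaving_iff:
  "L \<preceq> sentence_of_interleaving c \<longleftrightarrow>
    (\<exists>T. concat T = c \<and> map (map (case_sum snd snd)) T = sentence_words L
      \<and> (\<forall>t\<in>set T. successively joined t))"
proof (rule refines_segments_iff)
  show "sentence_words (sentence_of_interleaving c)
      = map (map (case_sum snd snd)) (segments joined c)"
    unfolding sentence_of_interleaving_def tilde.rep_eq
    by (auto intro!: filter_True dest: segments_nonempty)
qed

section \<open>Counting splittings and interleavings\<close>

lemma joined_Inl_Inl [simp]: "joined (Inl p) (Inl q) \<longleftrightarrow> same_tag p q"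
  and joined_Inr_Inr [simp]: "joined (Inr p) (Inr q) \<longleftrightarrow> same_tag p q"
  by (cases p; cases q; simp)+

text \<open>A seam from \<open>Inl\<close> to \<open>Inr\<close> is always joined, so it imposes no
  condition.\<close>

lemma successively_joined_append:
  "successively joined (map Inl x @ map Inr y) \<longleftrightarrow>
    successively same_tag x \<and> successively same_tag y"
proof -
  have "x = [] \<or> y = [] \<or> joined (last (map Inl x)) (hd (map Inr y))"
    by (cases "x = []"; cases "y = []") (simp_all add: last_map hd_map)
  then show ?thesis by (auto simp: successively_append_iff successively_map)
qed

text \<open>No \<open>Inr\<close> is joined to a following \<open>Inl\<close>, so after the first
  \<open>Inr\<close> only \<open>Inr\<close> can occur.\<close>

lemma successively_joined_obtain:
  assumes "successively joined t"
  obtains x y where "t = map Inl x @ map Inr y"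
proof -
  have "\<exists>x y. t = map Inl x @ map Inr y" using assms
  proof (induction t)
    case (Cons z t)
    then obtain x y where t: "t = map Inl x @ map Inr y"
      by (auto simp: successively_Cons)
    show ?case
    proof (cases z)
      case (Inl p)
      then show ?thesis using t by (intro exI[of _ "p # x"] exI[of _ y]) simp
    next
      case (Inr p)
      have "x = []"
        using Cons.prems t Inr by (cases x) auto
      then show ?thesis using t Inr by (intro exI[of _ "[]"] exI[of _ "p # y"]) simp
    qed
  qed simp
  then show thesis using that by blast
qed

text \<open>The marks record the origin of each letter, which reduces shuffling to two
  projections.\<close>

lemma shuffles_Inl_Inr_iff:
  "c \<in> shuffles (map Inl a) (map Inr b) \<longleftrightarrow>
    map projl (filter isl c) = a \<and> map projr (filter (\<lambda>z. \<not> isl z) c) = b"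
proof (induction c arbitrary: a b)
  case (Cons z c)
  show ?case
    unfolding Cons_in_shuffles_iff map_tl[symmetric] Cons.IH
    by (cases z; cases a; cases b) auto
qed auto

section \<open>The two bijections\<close>

definition tagged_splittings ::
    "'a sentence \<Rightarrow> 'a sentence \<Rightarrow> 'a sentence \<Rightarrow> ((nat \<times> 'a) list \<times> (nat \<times> 'a) list) list set"
  where "tagged_splittings J K L = {E.
    concat (map fst E) = tagged_letters J \<and> concat (map snd E) = tagged_letters K \<and>
    map (\<lambda>(x, y). map snd x @ map snd y) E = sentence_words L \<and>
    (\<forall>(x, y)\<in>set E. successively same_tag x \<and> successively same_tag y)}"

lemma concat_inject_length:
  "concat X = concat Y \<Longrightarrow> map length X = map length Y \<Longrightarrow> X = Y"
proof (induction X arbitrary: Y)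
  case (Cons x X)
  then show ?case by (cases Y) auto
qed simp

text \<open>\<open>map f\<close> preserves lengths, and a cutting of a fixed list is determined by
  its block lengths. This gives injectivity in both bijections.\<close>

lemma concat_inject_map:
  assumes "concat X = concat Y" "map (map f) X = map (map f) Y"
  shows "X = Y"
proof (rule concat_inject_length[OF assms(1)])
  have "map length (map (map f) X) = map length (map (map f) Y)" using assms(2) by simp
  then show "map length X = map length Y" by (simp add: comp_def)
qed

lemma map_fst_snd_eqI: "map fst E = map fst E' \<Longrightarrow> map snd E = map snd E' \<Longrightarrow> E = E'"
  by (metis zip_map_fst_snd)

text \<open>Forgetting tags loses nothing, since both components are cuttings of the fixed lists
  \<open>tagged_letters J\<close> and \<open>tagged_letters K\<close>.\<close>

lemma bij_betw_splittings:
  "bij_betw (map (map_prod (map snd) (map snd))) (tagged_splittings J K L)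
    {D \<in> splittings L. tilde (map fst D) \<preceq> J \<and> tilde (map snd D) \<preceq> K}"
    (is "bij_betw ?g ?E ?D")
  unfolding bij_betw_def
proof
  show "inj_on ?g ?E"
  proof (rule inj_onI)
    fix E E' assume E: "E \<in> ?E" "E' \<in> ?E" and eq: "?g E = ?g E'"
    have "map fst (?g E) = map fst (?g E')" "map snd (?g E) = map snd (?g E')"
      using eq by simp_all
    then have "map (map snd) (map fst E) = map (map snd) (map fst E')"
      "map (map snd) (map snd E) = map (map snd) (map snd E')"
      by (simp_all add: comp_def)
    then show "E = E'"
      using E unfolding tagged_splittings_def
      by (intro map_fst_snd_eqI) (auto intro: concat_inject_map)
  qed
  show "?g ` ?E = ?D"
  proof (intro subset_antisym subsetI)
    fix D assume "D \<in> ?g ` ?E"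
    then obtain E where E: "E \<in> ?E" "D = ?g E" by blast
    have "D \<in> splittings L"
      using E by (simp add: splittings_def tagged_splittings_def comp_def case_prod_unfold)
    moreover have "tilde (map fst D) \<preceq> J"
      using E unfolding tilde_refines_iff tagged_splittings_def
      by (intro exI[of _ "map fst E"]) (auto simp: comp_def)
    moreover have "tilde (map snd D) \<preceq> K"
      using E unfolding tilde_refines_iff tagged_splittings_def
      by (intro exI[of _ "map snd E"]) (auto simp: comp_def)
    ultimately show "D \<in> ?D" by simp
  next
    fix D assume D: "D \<in> ?D"
    obtain X where X: "concat X = tagged_letters J" "map (map snd) X = map fst D"
        "\<forall>x\<in>set X. successively same_tag x"
      using D unfolding tilde_refines_iff by blast
    obtain Y where Y: "concat Y = tagged_letters K" "map (map snd) Y = map snd D"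
        "\<forall>x\<in>set Y. successively same_tag x"
      using D unfolding tilde_refines_iff by blast
    have len: "length X = length D" "length Y = length D"
      using X(2) Y(2) by (metis length_map)+
    have "map fst (?g E) = map (map snd) (map fst E)" "map snd (?g E) = map (map snd) (map snd E)"
      for E :: "((nat \<times> 'a) list \<times> (nat \<times> 'a) list) list"
      by (simp_all add: comp_def)
    \<comment> \<open>The blocks of \<open>X\<close> and \<open>Y\<close> are the tagged
      \<open>u\<close> and \<open>v\<close> parts of \<open>D\<close>, so zipping them gives the
      preimage.\<close>
    then have g: "?g (zip X Y) = D"
      using len by (intro map_fst_snd_eqI) (simp_all only: map_fst_zip map_snd_zip X(2) Y(2))
    have "map (\<lambda>(x, y). map snd x @ map snd y) (zip X Y)
        = map (\<lambda>(u, v). u @ v) (?g (zip X Y))"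
      by (simp add: comp_def case_prod_beta)
    also have "\<dots> = sentence_words L" using D unfolding g splittings_def by simp
    finally have "zip X Y \<in> ?E"
      using X Y len unfolding tagged_splittings_def
      by (auto dest: set_zip_leftD set_zip_rightD)
    then show "D \<in> ?g ` ?E" using g by (metis image_eqI)
  qed
qed

text \<open>The words of \<open>L\<close> fix where the interleaving is cut, and each piece splits
  uniquely where \<open>Inl\<close> changes to \<open>Inr\<close>.\<close>

lemma bij_betw_interleavings:
  "bij_betw (\<lambda>E. concat (map (\<lambda>(x, y). map Inl x @ map Inr y) E)) (tagged_splittings J K L)
    {c \<in> interleavings J K. L \<preceq> sentence_of_interleaving c}"
    (is "bij_betw ?g ?E ?C")
  unfolding bij_betw_def
proof
  let ?h = "\<lambda>(x :: (nat \<times> 'a) list, y :: (nat \<times> 'a) list). map Inl x @ map Inr y"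
  have untag: "map (map (case_sum snd snd)) (map ?h E)
      = map (\<lambda>(x, y). map snd x @ map snd y) E" for E :: "((nat \<times> 'a) list \<times> (nat \<times> 'a) list) list"
    by (simp add: comp_def case_prod_beta)
  have left: "map projl (filter isl (?g E)) = concat (map fst E)"
    and right: "map projr (filter (\<lambda>z. \<not> isl z) (?g E)) = concat (map snd E)"
    for E :: "((nat \<times> 'a) list \<times> (nat \<times> 'a) list) list"
    by (induction E) (auto simp: filter_map comp_def)
  show "inj_on ?g ?E"
  proof (rule inj_onI)
    fix E E' assume E: "E \<in> ?E" "E' \<in> ?E" and eq: "?g E = ?g E'"
    have "map (map (case_sum snd snd)) (map ?h E) = map (map (case_sum snd snd)) (map ?h E')"
      using E unfolding untag tagged_splittings_def by simp
    then have map_eq: "map ?h E = map ?h E'" using eq concat_inject_map by blast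
    have "inj ?h"
    proof (rule injI)
      fix p q :: "(nat \<times> 'a) list \<times> (nat \<times> 'a) list" assume "?h p = ?h q"
      \<comment> \<open>On one-element lists, \<open>left\<close> and \<open>right\<close> read off
        the two components of a pair.\<close>
      then have "?g [p] = ?g [q]" by simp
      then show "p = q" using left[of "[p]"] left[of "[q]"] right[of "[p]"] right[of "[q]"]
        by (simp add: prod_eq_iff)
    qed
    from inj_map_eq_map[OF this] map_eq show "E = E'" by (rule iffD1)
  qed
  show "?g ` ?E = ?C"
  proof (intro subset_antisym subsetI)
    fix c assume "c \<in> ?g ` ?E"
    then obtain E where E: "E \<in> ?E" "c = ?g E" by blast
    have "c \<in> interleavings J K"
      using E left[of E] right[of E] unfolding interleavings_def shuffles_Inl_Inr_iff tagged_splittings_def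
      by simp
    moreover have "L \<preceq> sentence_of_interleaving c"
      unfolding refines_sentence_of_interleaving_iff
      using E untag[of E] unfolding tagged_splittings_def
      by (intro exI[of _ "map ?h E"]) (auto simp: successively_joined_append)
    ultimately show "c \<in> ?C" by simp
  next
    fix c assume c: "c \<in> ?C"
    then obtain T where T: "concat T = c" "map (map (case_sum snd snd)) T = sentence_words L"
        "\<forall>t\<in>set T. successively joined t"
      unfolding refines_sentence_of_interleaving_iff by blast
    have "\<forall>t\<in>set T. \<exists>p. t = ?h p"
    proof
      fix t assume "t \<in> set T"
      then obtain x y where "t = map Inl x @ map Inr y"
        using T(3) successively_joined_obtain by blast
      then show "\<exists>p. t = ?h p" by (intro exI[of _ "(x, y)"]) simp
    qed
    then obtain E where E: "T = map ?h E"
      unfolding ex_map_conv[symmetric] by (rule exE)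
    have "successively same_tag x \<and> successively same_tag y" if "(x, y) \<in> set E" for x y
      using T(3) that unfolding E by (force simp: successively_joined_append)
    then have "E \<in> ?E"
      using c T(1,2) left[of E] right[of E] untag[of E]
      unfolding E interleavings_def shuffles_Inl_Inr_iff tagged_splittings_def
      by auto
    then show "c \<in> ?g ` ?E" using T(1) E by blast
  qed
qed

lemma card_interleavings_eq_card_splittings:
  "card {c \<in> interleavings J K. L \<preceq> sentence_of_interleaving c}
    = card {D \<in> splittings L. tilde (map fst D) \<preceq> J \<and> tilde (map snd D) \<preceq> K}"
  using bij_betw_same_card[OF bij_betw_splittings] bij_betw_same_card[OF bij_betw_interleavings]
  by metis

section \<open>Expansion in the ribbon basis\<close>

lemma finite_map_fibre:
  assumes "\<And>w. finite {d. f d = w}"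
  shows "finite {D. map f D = ws}"
proof (induction ws)
  case (Cons w ws)
  have "{D. map f D = w # ws} \<subseteq> (\<lambda>(d, D). d # D) ` ({d. f d = w} \<times> {D. map f D = ws})"
    by (auto simp: map_eq_Cons_conv)
  then show ?case using Cons assms finite_subset by blast
qed simp

lemma finite_splittings: "finite (splittings L)"
  unfolding splittings_def
proof (rule finite_map_fibre)
  fix w :: "'a list"
  have "{d. (\<lambda>(u, v). u @ v) d = w} \<subseteq> (\<lambda>n. (take n w, drop n w)) ` {..length w}"
  proof clarify
    fix u v assume "w = u @ v"
    then show "(u, v) \<in> (\<lambda>n. (take n (u @ v), drop n (u @ v))) ` {..length (u @ v)}"
      by (intro image_eqI[of _ _ "length u"]) auto
  qed
  then show "finite {d. (\<lambda>(u, v). u @ v) d = w}" using finite_subset by blast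
qed

lemma lookup_scale [simp]: "Poly_Mapping.lookup (c \<cdot> x) k = c * Poly_Mapping.lookup x k"
  unfolding scale_def by (simp add: Poly_Mapping.map.rep_eq when_def)

lemma lookup_tensor [simp]:
  "Poly_Mapping.lookup (x \<otimes> y) (P, Q) = Poly_Mapping.lookup x P * Poly_Mapping.lookup y Q"
proof -
  have "Poly_Mapping.lookup (x \<otimes> y) (P, Q) =
      (\<Sum>P'\<in>Poly_Mapping.keys x. if P' = P then
        (\<Sum>Q'\<in>Poly_Mapping.keys y. if Q' = Q then Poly_Mapping.lookup x P' * Poly_Mapping.lookup y Q' else 0)
        else 0)"
    unfolding tensor_def lookup_sum lookup_single
    by (intro sum.cong refl) (auto simp: when_def intro!: sum.cong sum.neutral)
  also have "\<dots> = Poly_Mapping.lookup x P * Poly_Mapping.lookup y Q"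
    by (simp add: in_keys_iff)
  finally show ?thesis .
qed

lemma tensor_sum_sum: "(\<Sum>a\<in>A. f a) \<otimes> (\<Sum>b\<in>B. g b) = (\<Sum>(a, b)\<in>A \<times> B. f a \<otimes> g b)"
  by (rule poly_mapping_eqI) (auto simp: lookup_sum sum_product sum.cartesian_product case_prod_beta)

lemma sum_scale_left: "(\<Sum>a\<in>A. f a) \<cdot> x = (\<Sum>a\<in>A. f a \<cdot> x)"
  by (rule poly_mapping_eqI) (simp add: lookup_sum sum_distrib_right)

lemma scale_sum_right: "c \<cdot> (\<Sum>a\<in>A. f a) = (\<Sum>a\<in>A. c \<cdot> f a)"
  by (rule poly_mapping_eqI) (simp add: lookup_sum sum_distrib_left)

lemma scale_scale: "c \<cdot> d \<cdot> x = (c * d) \<cdot> x"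
  by (rule poly_mapping_eqI) (simp add: mult.assoc)

lemma scale_zero_left: "0 \<cdot> x = 0"
  by (rule poly_mapping_eqI) simp

lemma scale_one_or_zero: "(if b then 1 else 0) \<cdot> x = (if b then x else 0)"
  by (rule poly_mapping_eqI) simp

section \<open>From the basis \<open>H\<close> to the ribbons\<close>

lemma pairing_F_sum_right: "\<langle>F J, \<Sum>a\<in>A. x a\<rangle> = (\<Sum>a\<in>A. \<langle>F J, x a\<rangle>)"
  unfolding pairing_F lookup_sum by (rule sum.swap)

text \<open>Elements are determined by their pairings with all \<open>F J\<close>; here both sides
  give 1 or 0 according to whether \<open>L \<preceq> J\<close>.\<close>

lemma H_eq_sum_R: "H L = (\<Sum>J\<in>{J. L \<preceq> J}. R J)"
proof (rule dual_F_unique)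
  fix J
  show "\<langle>F J, H L\<rangle> = \<langle>F J, \<Sum>J\<in>{J. L \<preceq> J}. R J\<rangle>"
    unfolding pairing_F_sum_right pairing_F_R
    by (simp add: pairing_F H_def lookup_single when_def finite_refinements finite_coarsenings)
qed

text \<open>The coproduct sums over the keys of its argument; the pairing is brought to the same
  range.\<close>

lemma pairing_eq_sum_keys_right:
  "\<langle>f, x\<rangle> = (\<Sum>L\<in>Poly_Mapping.keys x. Poly_Mapping.lookup f L * Poly_Mapping.lookup x L)"
  unfolding pairing_def by (rule sum.mono_neutral_cong) (auto simp: in_keys_iff)

text \<open>The structure constant seen from both sides: the coefficient of
  \<open>R J \<otimes> R K\<close> in the coproduct of \<open>H L\<close>, and of \<open>M L\<close>
  in \<open>F_sum (J \<star>\<^sub>F K)\<close>.\<close>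

definition splitting_coeff :: "'a sentence \<Rightarrow> 'a sentence \<Rightarrow> 'a sentence \<Rightarrow> nat"
  where "splitting_coeff J K L =
    card {D \<in> splittings L. tilde (map fst D) \<preceq> J \<and> tilde (map snd D) \<preceq> K}"

lemma lookup_F_sum_fundamental_shuffle:
  "Poly_Mapping.lookup (F_sum (J \<star>\<^sub>F K) :: ('a, 'k::field_char_0) qsym) L = of_nat (splitting_coeff J K L)"
proof -
  have fin: "finite (interleavings J K)" unfolding interleavings_def by simp
  have "(F_sum (J \<star>\<^sub>F K) :: ('a, 'k) qsym)
      = (\<Sum>c\<in>interleavings J K. F (sentence_of_interleaving c))"
    unfolding F_sum_def fundamental_shuffle_def
    by (simp add: image_mset.compositionality comp_def sum_unfold_sum_mset)
  then show ?thesis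
    using fin unfolding splitting_coeff_def card_interleavings_eq_card_splittings[symmetric]
    by (simp add: lookup_sum lookup_F sum.If_cases Int_def)
qed

lemma pairing_F_sum_fundamental_shuffle:
  "\<langle>F_sum (J \<star>\<^sub>F K), x\<rangle>
    = (\<Sum>L\<in>Poly_Mapping.keys x. Poly_Mapping.lookup x L * of_nat (splitting_coeff J K L))"
  unfolding pairing_eq_sum_keys_right lookup_F_sum_fundamental_shuffle
  by (simp add: mult.commute)

text \<open>A finite set of pairs outside which \<open>splitting_coeff\<close> vanishes for this
  \<open>L\<close>.\<close>

definition coarsened_splittings :: "'a sentence \<Rightarrow> ('a sentence \<times> 'a sentence) set"
  where "coarsened_splittings L =
    (\<Union>D\<in>splittings L. {J. tilde (map fst D) \<preceq> J} \<times> {K. tilde (map snd D) \<preceq> K})"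

lemma finite_coarsened_splittings: "finite (coarsened_splittings L)"
  unfolding coarsened_splittings_def by (simp add: finite_splittings finite_coarsenings)

lemma splitting_coeff_eq_0: "(J, K) \<notin> coarsened_splittings L \<Longrightarrow> splitting_coeff J K L = 0"
  unfolding coarsened_splittings_def splitting_coeff_def by (auto simp: card_eq_0_iff)

text \<open>The index set \<open>S\<close> is left free so that all \<open>L\<close> in the support
  of a ribbon can share one.\<close>

lemma coproduct_H_eq_sum_R:
  assumes "finite S" "coarsened_splittings L \<subseteq> S"
  shows "(coproduct_H L :: ('a, 'k::field_char_0) nsym_tensor)
    = (\<Sum>(J, K)\<in>S. of_nat (splitting_coeff J K L) \<cdot> (R J \<otimes> R K))"
proof -
  let ?P = "\<lambda>D J K. tilde (map fst D) \<preceq> J \<and> tilde (map snd D) \<preceq> K"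
  have "(coproduct_H L :: ('a, 'k) nsym_tensor) = (\<Sum>D\<in>splittings L.
      \<Sum>(J, K)\<in>{J. tilde (map fst D) \<preceq> J} \<times> {K. tilde (map snd D) \<preceq> K}. R J \<otimes> R K)"
    unfolding coproduct_H_def H_eq_sum_R tensor_sum_sum ..
  \<comment> \<open>The indicator makes the inner range independent of \<open>D\<close>, so the sums
    can be exchanged.\<close>
  also have "\<dots> = (\<Sum>D\<in>splittings L. \<Sum>(J, K)\<in>S. (if ?P D J K then 1 else 0) \<cdot> (R J \<otimes> R K))"
  proof (rule sum.cong[OF refl], rule sum.mono_neutral_cong_left[OF assms(1)])
    fix D assume "D \<in> splittings L"
    then show "{J. tilde (map fst D) \<preceq> J} \<times> {K. tilde (map snd D) \<preceq> K} \<subseteq> S"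
      using assms(2) unfolding coarsened_splittings_def by blast
  qed (auto simp: scale_one_or_zero split: if_splits)
  also have "\<dots> = (\<Sum>(J, K)\<in>S. \<Sum>D\<in>splittings L. (if ?P D J K then 1 else 0) \<cdot> (R J \<otimes> R K))"
    unfolding case_prod_beta by (rule sum.swap)
  also have "\<dots> = (\<Sum>(J, K)\<in>S. of_nat (splitting_coeff J K L) \<cdot> (R J \<otimes> R K))"
    unfolding sum_scale_left[symmetric] splitting_coeff_def
    by (simp add: finite_splittings sum.If_cases Int_def)
  finally show ?thesis .
qed

theorem corollary5p7:
  fixes I :: "'a::finite sentence"
  shows "\<Delta> (R I :: ('a, 'k::field_char_0) nsym) =
    (\<Sum>(J, K). \<langle>F_sum (J \<star>\<^sub>F K), R I\<rangle> \<cdot> (R J \<otimes> R K))"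
proof -
  let ?r = "R I :: ('a, 'k) nsym"
  let ?S = "\<Union>L\<in>Poly_Mapping.keys ?r. coarsened_splittings L"
  let ?t = "\<lambda>(J, K). \<langle>F_sum (J \<star>\<^sub>F K), ?r\<rangle> \<cdot> (R J \<otimes> R K)"
  have fin: "finite ?S" by (simp add: finite_coarsened_splittings)
  have "\<Delta> ?r = (\<Sum>L\<in>Poly_Mapping.keys ?r. \<Sum>(J, K)\<in>?S.
      (Poly_Mapping.lookup ?r L * of_nat (splitting_coeff J K L)) \<cdot> (R J \<otimes> R K))"
    unfolding coproduct_def
  proof (rule sum.cong[OF refl])
    fix L assume "L \<in> Poly_Mapping.keys ?r"
    then have "coarsened_splittings L \<subseteq> ?S" by blast
    note coproduct = coproduct_H_eq_sum_R[OF fin this]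
    show "Poly_Mapping.lookup ?r L \<cdot> coproduct_H L = (\<Sum>(J, K)\<in>?S.
        (Poly_Mapping.lookup ?r L * of_nat (splitting_coeff J K L)) \<cdot> (R J \<otimes> R K))"
      unfolding coproduct scale_sum_right case_prod_beta scale_scale ..
  qed
  \<comment> \<open>After exchanging the sums, the scalars at \<open>(J, K)\<close> add up to the
    pairing, computed over the keys of \<open>R I\<close>.\<close>
  also have "\<dots> = (\<Sum>p\<in>?S. ?t p)"
    unfolding pairing_F_sum_fundamental_shuffle sum_scale_left case_prod_beta
    by (rule sum.swap)
  \<comment> \<open>The sum over all pairs is a \<open>Sum_any\<close>, ranging over the non-zero
    terms, and these all lie in \<open>?S\<close>.\<close>
  also have "\<dots> = (\<Sum>p. ?t p)"
  proof (rule Sum_any.expand_superset[OF fin, symmetric], rule subsetI)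
    fix p assume p: "p \<in> {p. ?t p \<noteq> 0}"
    obtain J K where JK: "p = (J, K)" by (cases p)
    show "p \<in> ?S"
    proof (rule ccontr)
      assume "p \<notin> ?S"
      then have "\<langle>F_sum (J \<star>\<^sub>F K), ?r\<rangle> = 0"
        unfolding JK pairing_F_sum_fundamental_shuffle
        by (intro sum.neutral) (auto simp: splitting_coeff_eq_0)
      then have "?t p = 0" unfolding JK by (simp add: scale_zero_left)
      with p show False by simp
    qed
  qed
  finally show ?thesis .
qed

end
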